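(* Let $G$ be a tree on $n$ vertices. Then $G$ does not allow the characteristic polynomial a square, i.e. there is no matrix $A \in S(G)$ whose characteristic polynomial is the square of a polynomial in $\mathbb{R}[x]$.
   Context: For a simple undirected graph $G$ with vertex set $\{1,\ldots,n\}$, $S(G)$ is the set of all real symmetric $n\times n$ matrices $A=(a_{ij})$ such that, for $i\neq j$, $a_{ij}\neq 0$ if and only if $i$ and $j$ are adjacent in $G$ (diagonal entries are unrestricted). The characteristic polynomial of $A$ is $\det(xI_n-A)$. $G$ is said to allow the characteristic polynomial a square if there exists $A\in S(G)$ whose characteristic polynomial equals $g(x)^2$ for some $g(x)\in\mathbb{R}[x]$; equivalently, all eigenvalues of $A$ have even multiplicity. *)

theory Defs
  imports "Jordan_Normal_Form.Char_Poly" "Graph_Theory.Graph_Theory"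
begin

text \<open>
  A finite simple undirected graph is a \<open>pair_graph\<close>: a finite, loop-free digraph
  without parallel arcs whose arc relation is symmetric, so that \<open>i\<close> and \<open>j\<close> are adjacent iff
  \<open>(i, j) \<in> parcs G\<close>.

  The predicates \<open>forest\<close> and \<open>tree\<close> of the library are not suitable here: they are based on directed
  cycles, and in a symmetric digraph every edge yields the directed cycle \<open>u, v, u\<close>. The cycles of
  the undirected graph are exactly the directed cycles of length at least three.
  The library's \<open>connected\<close> excludes the graph without vertices.
\<close>

definition undirected_tree :: "'a pair_pre_digraph \<Rightarrow> bool" where
  "undirected_tree G \<longleftrightarrow>
     pair_graph G \<and>
     Digraph_Component.connected (with_proj G) \<and>
     \<not> (\<exists>p. pre_digraph.cycle (with_proj G) p \<and> 3 \<le> length p)"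

text \<open>
  Matrix indices start at \<open>0\<close>, so the vertex set of a graph of order \<open>n\<close> is \<open>{0..<n}\<close>
  instead of \<open>{1..n}\<close>.
\<close>

definition symmetric_matrices_of :: "nat \<Rightarrow> nat pair_pre_digraph \<Rightarrow> real mat set" where
  "symmetric_matrices_of n G =
     {A \<in> carrier_mat n n.
        transpose_mat A = A \<and>
        (\<forall>i<n. \<forall>j<n. i \<noteq> j \<longrightarrow> (A $$ (i, j) \<noteq> 0 \<longleftrightarrow> (i, j) \<in> parcs G))}"

definition allows_square_char_poly :: "nat \<Rightarrow> nat pair_pre_digraph \<Rightarrow> bool" where
  "allows_square_char_poly n G \<longleftrightarrow>
     (\<exists>A \<in> symmetric_matrices_of n G. \<exists>g :: real poly. char_poly A = g ^ 2)"

end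

theory Submission
  imports Defs "HOL-Analysis.Elementary_Metric_Spaces"
begin

text \<open>
  For real \<open>t\<close>, eliminate the leaves of the tree from \<open>t I - A\<close> one after the other, by symmetric
  Gaussian elimination. Removing a leaf \<open>l\<close> with neighbour \<open>u\<close> replaces the diagonal entry \<open>d u\<close> by
  \<open>d u - (a u l)\<^sup>2 / d l\<close>; the pivots are thus functions of \<open>t\<close> that tend to infinity with \<open>t\<close> and are
  continuous to the right of the zeros of the pivots used before. To the right of the last zero of
  \<open>d l\<close>, the new entry at \<open>u\<close> still takes negative values, since \<open>d l\<close> is positive and arbitrarily
  small there. So when a single vertex is left, there is a \<open>t\<close> for which its pivot is negative while
  all previous ones are positive. There \<open>det (t I - A) < 0\<close>, so the characteristic polynomial of
  \<open>A\<close> is not a square.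
\<close>

section \<open>Building trees by adding leaves\<close>

text \<open>The condition on \<open>l\<close> concerns only the vertices already present. The order
  of insertion, reversed, is therefore an elimination order in which every removed vertex is a leaf
  of what is left.\<close>

inductive leaf_built :: "('a \<Rightarrow> 'a \<Rightarrow> bool) \<Rightarrow> 'a set \<Rightarrow> bool" for E where
  single: "leaf_built E {r}"
| add_leaf: "leaf_built E (insert l V)"
  if "leaf_built E V" "l \<notin> V" "u \<in> V" "E u l" "\<And>v. v \<in> V \<Longrightarrow> E v l \<Longrightarrow> v = u"

context pair_graph
begin

text \<open>The path must stay inside \<open>V\<close> because it will be closed to a cycle through
  a vertex outside \<open>V\<close>. From a new leaf one steps to \<open>u\<close> and continues by
  induction; a path towards the leaf is such a path reversed.\<close>

lemma leaf_built_apath: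
  assumes "leaf_built (\<lambda>u v. (u, v) \<in> parcs G) V" and "V \<subseteq> pverts G"
    and "x \<in> V" and "y \<in> V"
  shows "\<exists>p. apath x p y \<and> set (awalk_verts x p) \<subseteq> V"
  using assms
proof (induction arbitrary: x y rule: leaf_built.induct)
  case (single r)
  then show ?case
    by (intro exI[of _ "[]"]) (auto simp: apath_Nil_iff)
next
  case (add_leaf V l u)
  note l = add_leaf.hyps(2-4)
  have from_leaf: "\<exists>p. apath l p y \<and> set (awalk_verts l p) \<subseteq> insert l V" if y: "y \<in> V" for y
  proof -
    obtain p where p: "apath u p y" "set (awalk_verts u p) \<subseteq> V"
      using add_leaf.IH[of u y] add_leaf.prems(1) l y by auto
    have "(l, u) \<in> parcs G"
      using l by (auto intro: arcs_symmetric)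
    then have "apath l ((l, u) # p) y"
      using p l add_leaf.prems(1) by (auto simp: apath_Cons_iff)
    then show ?thesis
      using p by (intro exI[of _ "(l, u) # p"]) auto
  qed
  consider "x = l" "y = l" | "x = l" "y \<in> V" | "x \<in> V" "y = l" | "x \<in> V" "y \<in> V"
    using add_leaf.prems by auto
  then show ?case
  proof cases
    case 1
    then show ?thesis
      using add_leaf.prems by (intro exI[of _ "[]"]) (auto simp: apath_Nil_iff)
  next
    case 2
    then show ?thesis using from_leaf by auto
  next
    case 3
    then obtain p where p: "apath l p x" "set (awalk_verts l p) \<subseteq> insert l V"
      using from_leaf by blast
    then have "awalk_verts x (rev_path p) = rev (awalk_verts l p)"
      by (auto simp: apath_def awalk_verts_rev_path)
    then show ?thesis
      using p 3 by (intro exI[of _ "rev_path p"]) auto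
  next
    case 4
    then show ?thesis using add_leaf.IH[of x y] add_leaf.prems(1) by blast
  qed
qed

lemma awalk_leaves_set:
  assumes "awalk x p y" and "x \<in> V" and "y \<notin> V"
  shows "\<exists>u v. (u, v) \<in> parcs G \<and> u \<in> V \<and> v \<notin> V"
  using assms
proof (induction p arbitrary: x)
  case Nil
  then show ?case by (auto simp: awalk_Nil_iff)
next
  case (Cons e p)
  then show ?case
    by (cases "snd e \<in> V") (auto simp: awalk_Cons_iff, metis prod.collapse)
qed

text \<open>An inclusion-maximal leaf-built set is everything: otherwise connectedness gives an arc
  from some \<open>u\<close> inside to some \<open>l\<close> outside. Only a second neighbour
  \<open>v\<close> of \<open>l\<close> could prevent adding \<open>l\<close>, and a path from
  \<open>u\<close> to \<open>v\<close> would then close a cycle through \<open>l\<close>.\<close>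

lemma leaf_built_pverts:
  assumes connected: "Digraph_Component.connected (with_proj G)"
    and acyclic: "\<not> (\<exists>p. cycle p \<and> 3 \<le> length p)"
  shows "leaf_built (\<lambda>u v. (u, v) \<in> parcs G) (pverts G)"
proof -
  let ?P = "\<lambda>V. leaf_built (\<lambda>u v. (u, v) \<in> parcs G) V \<and> V \<subseteq> pverts G"
  have sc: "strongly_connected (with_proj G)"
    using connected symmetric_connected_imp_strongly_connected sym_arcs by blast
  then obtain r where "r \<in> pverts G"
    by (auto simp: strongly_connected_def)
  then have "?P {r}"
    by (auto intro: leaf_built.single)
  moreover have "finite {V. ?P V}"
    by (rule finite_subset[of _ "Pow (pverts G)"]) (auto simp: pair_finite_verts)
  ultimately obtain V where V: "?P V" and max: "\<And>V'. ?P V' \<Longrightarrow> V \<subseteq> V' \<Longrightarrow> V' = V"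
    using finite_has_maximal[of "{V. ?P V}"] by (metis (no_types, lifting) empty_iff mem_Collect_eq)
  have "V \<noteq> {}"
    using V by (auto elim: leaf_built.cases)
  then obtain x where x: "x \<in> V" by auto
  have "V = pverts G"
  proof (rule ccontr)
    assume "V \<noteq> pverts G"
    then obtain y where y: "y \<in> pverts G" "y \<notin> V" using V by auto
    have "x \<rightarrow>\<^sup>*\<^bsub>with_proj G\<^esub> y"
      using sc x y V by (auto simp: strongly_connected_def)
    then obtain p where "awalk x p y"
      by (auto simp: reachable_awalk)
    then obtain u l where ul: "(u, l) \<in> parcs G" "u \<in> V" "l \<notin> V"
      using awalk_leaves_set x y by blast
    have "v = u" if v: "v \<in> V" "(v, l) \<in> parcs G" for v
    proof (rule ccontr)
      assume "v \<noteq> u"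
      obtain p where p: "apath u p v" "set (awalk_verts u p) \<subseteq> V"
        using leaf_built_apath V v ul by blast
      have walk: "awalk u (p @ [(v, l)]) l"
        using p v by (auto simp: apath_def awalk_simps intro: wellformed')
      then have "awalk l ((l, u) # p @ [(v, l)]) l"
        using ul by (auto simp: awalk_Cons_iff intro: arcs_symmetric)
      moreover have "distinct (awalk_verts u (p @ [(v, l)]))"
        using p ul walk by (auto simp: apath_def awalk_verts_append)
      ultimately have "cycle ((l, u) # p @ [(v, l)])"
        by (auto simp: cycle_def)
      \<comment> \<open>This rules out the degenerate cycle that runs along one edge and
        back.\<close>
      moreover have "p \<noteq> []"
        using p \<open>v \<noteq> u\<close> by (auto simp: apath_Nil_iff)
      then have "3 \<le> length ((l, u) # p @ [(v, l)])"
        by (cases p) auto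
      ultimately show False using acyclic by blast
    qed
    then have "?P (insert l V)"
      using V ul by (auto intro: leaf_built.add_leaf wellformed')
    with max[of "insert l V"] ul show False by auto
  qed
  with V show ?thesis by simp
qed

end

section \<open>Eliminating a leaf\<close>

text \<open>Vertices outside \<open>V\<close> keep their diagonal entry, so the pivots of eliminated
  vertices remain in the matrix. The size stays \<open>n\<close>, and an elimination step preserves
  the determinant exactly.\<close>

definition decoupled_mat :: "nat \<Rightarrow> (nat \<Rightarrow> nat \<Rightarrow> 'a) \<Rightarrow> nat set \<Rightarrow> (nat \<Rightarrow> 'a) \<Rightarrow> 'a :: zero mat" where
  "decoupled_mat n W V d =
     mat n n (\<lambda>(i, j). if i = j then d i else if i \<in> V \<and> j \<in> V then W i j else 0)"

lemma decoupled_mat_carrier [simp]: "decoupled_mat n W V d \<in> carrier_mat n n"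
  by (simp add: decoupled_mat_def)

lemma det_decoupled_mat_singleton:
  fixes d :: "nat \<Rightarrow> 'a :: comm_ring_1"
  shows "det (decoupled_mat n W {r} d) = (\<Prod>i<n. d i)"
proof -
  have "det (decoupled_mat n W {r} d) = prod_list (diag_mat (decoupled_mat n W {r} d))"
    by (rule det_upper_triangular) (auto simp: upper_triangular_def decoupled_mat_def)
  also have "diag_mat (decoupled_mat n W {r} d) = map d [0..<n]"
    by (auto simp: diag_mat_def decoupled_mat_def)
  finally show ?thesis
    by (simp add: prod.distinct_set_conv_list[of "[0..<n]", simplified] atLeast0LessThan[symmetric])
qed

text \<open>Subtracting \<open>W u l / d l\<close> times row \<open>l\<close> from row
  \<open>u\<close>, and then likewise for columns, clears the two entries that link \<open>l\<close>
  and \<open>u\<close>. As \<open>l\<close> has no other neighbour in \<open>V\<close>, the only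
  other change is at the diagonal entry of \<open>u\<close>.\<close>

lemma det_eliminate_leaf:
  fixes d :: "nat \<Rightarrow> 'a :: field"
  assumes "l < n" "u < n" "l \<notin> V" "u \<in> V" and "d l \<noteq> 0"
    and sym: "W l u = W u l"
    and leaf: "\<And>v. v \<in> V \<Longrightarrow> v \<noteq> u \<Longrightarrow> W v l = 0 \<and> W l v = 0"
  shows "det (decoupled_mat n W (insert l V) d) =
    det (decoupled_mat n W V (d(u := d u - (W u l)\<^sup>2 / d l)))"
proof -
  let ?M = "decoupled_mat n W (insert l V) d"
  let ?c = "- (W u l / d l)"
  have "u \<noteq> l" using assms by auto
  have "addcol ?c u l (addrow ?c u l ?M) = decoupled_mat n W V (d(u := d u - (W u l)\<^sup>2 / d l))"
    by (rule eq_matI)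
      (use assms \<open>u \<noteq> l\<close> in \<open>auto simp: decoupled_mat_def power2_eq_square field_simps\<close>)
  moreover have "det (addcol ?c u l (addrow ?c u l ?M)) = det ?M"
    using assms \<open>u \<noteq> l\<close> by (subst det_addcol[of _ n]) (auto simp: det_addrow[of _ n])
  ultimately show ?thesis by simp
qed

section \<open>A negative value of the determinant\<close>

text \<open>The limit bounds the set of points from \<open>t0\<close> on with
  \<open>f t \<le> 0\<close>, so this set is compact and has a greatest element \<open>z\<close>.
  Positivity to the right of \<open>z\<close> and continuity at \<open>z\<close> give
  \<open>0 \<le> f z\<close>.\<close>

lemma last_zero:
  fixes f :: "real \<Rightarrow> real"
  assumes cont: "continuous_on {s<..} f" and lim: "filterlim f at_top at_top"
    and t0: "s < t0" "f t0 \<le> 0"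
  obtains z where "s < z" "f z = 0" "\<And>t. z < t \<Longrightarrow> 0 < f t"
proof -
  obtain T where T: "\<And>t. T \<le> t \<Longrightarrow> 0 < f t"
    using lim by (auto simp: filterlim_at_top_dense eventually_at_top_linorder)
  have cont': "continuous_on {t0..T} f"
    using cont by (rule continuous_on_subset) (use t0 in auto)
  have "t0 \<le> T"
    using T[of t0] t0 by force
  have "compact {t \<in> {t0..T}. f t \<le> 0}"
  proof -
    have "closed {t \<in> {t0..T}. f t \<le> 0}"
      using continuous_on_closed_Collect_le[OF cont' continuous_on_const] by auto
    then have "compact ({t0..T} \<inter> {t \<in> {t0..T}. f t \<le> 0})"
      by (intro compact_Int_closed) auto
    also have "{t0..T} \<inter> {t \<in> {t0..T}. f t \<le> 0} = {t \<in> {t0..T}. f t \<le> 0}" by blast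
    finally show ?thesis .
  qed
  moreover have "{t \<in> {t0..T}. f t \<le> 0} \<noteq> {}"
    using t0 \<open>t0 \<le> T\<close> by (auto intro!: exI[of _ t0])
  ultimately obtain z where z: "z \<in> {t0..T}" "f z \<le> 0"
    and max: "\<And>t. t \<in> {t0..T} \<Longrightarrow> f t \<le> 0 \<Longrightarrow> t \<le> z"
    using compact_attains_sup[of "{t \<in> {t0..T}. f t \<le> 0}"] by auto
  have pos: "0 < f t" if "z < t" for t
    using T[of t] max[of t] that z by (cases "T \<le> t") force+
  have "isCont f z"
    using cont z t0 by (auto simp: continuous_on_eq_continuous_at)
  then have "(f \<longlongrightarrow> f z) (at_right z)"
    by (auto simp: isCont_def intro: tendsto_mono[OF at_le])
  then have "0 \<le> f z"
    by (rule tendsto_lowerbound)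
      (auto simp: eventually_at_right_field intro!: exI[of _ "z + 1"] less_imp_le[OF pos])
  with z pos t0 show thesis by (intro that[of z]) auto
qed

lemma schur_complement_tendsto:
  fixes f g :: "real \<Rightarrow> real"
  assumes f: "filterlim f at_top at_top" and g: "filterlim g at_top at_top"
  shows "filterlim (\<lambda>t. g t - c / f t) at_top at_top"
proof -
  have "((\<lambda>t. - (c / f t)) \<longlongrightarrow> - 0) at_top"
    by (intro tendsto_minus real_tendsto_divide_at_top[OF tendsto_const f])
  from filterlim_tendsto_add_at_top[OF this g] show ?thesis
    by (simp add: algebra_simps)
qed

text \<open>Where \<open>f t\<close> is positive, the inequality amounts to
  \<open>g t * f t < c\<close>, and this product tends to \<open>0\<close> as \<open>t\<close>
  decreases to \<open>z\<close>.\<close>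

lemma schur_complement_negative:
  fixes f g :: "real \<Rightarrow> real"
  assumes "isCont f z" "isCont g z" "f z = 0" and pos: "\<And>t. z < t \<Longrightarrow> 0 < f t" and "0 < c"
  shows "\<exists>t>z. g t - c / f t < 0"
proof -
  have "((\<lambda>t. g t * f t) \<longlongrightarrow> g z * f z) (at_right z)"
    using assms by (intro tendsto_mult) (auto simp: isCont_def intro: tendsto_mono[OF at_le])
  then have "eventually (\<lambda>t. g t * f t < c) (at_right z)"
    using assms by (auto dest: order_tendstoD(2)[where a = c])
  then obtain b where b: "z < b" "\<And>t. z < t \<Longrightarrow> t < b \<Longrightarrow> g t * f t < c"
    by (auto simp: eventually_at_right_field)
  obtain t where t: "z < t" "t < b" using dense b by blast
  then show ?thesis
    using b(2)[of t] pos[of t] by (intro exI[of _ t]) (auto simp: field_simps)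
qed

text \<open>The threshold \<open>s\<close> may move to the right at each elimination, to keep the
  new pivot positive and the new entry continuous beyond it. What has to survive is the last
  assumption; for a single vertex it makes exactly one factor of the determinant negative.\<close>

lemma det_decoupled_mat_negative:
  fixes W :: "nat \<Rightarrow> nat \<Rightarrow> real" and d :: "nat \<Rightarrow> real \<Rightarrow> real"
  assumes "leaf_built (\<lambda>i j. W i j \<noteq> 0) V" and "V \<subseteq> {..<n}"
    and sym: "\<And>i j. i < n \<Longrightarrow> j < n \<Longrightarrow> W i j = W j i"
    and "\<And>v. v \<in> V \<Longrightarrow> continuous_on {s<..} (d v)"
    and "\<And>v. v \<in> V \<Longrightarrow> filterlim (d v) at_top at_top"
    and "\<And>i t. i \<in> {..<n} - V \<Longrightarrow> s < t \<Longrightarrow> 0 < d i t"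
    and "\<exists>v\<in>V. \<exists>t>s. d v t < 0"
  shows "\<exists>t>s. det (decoupled_mat n W V (\<lambda>i. d i t)) < 0"
  using assms(1,2,4-)
proof (induction arbitrary: s d rule: leaf_built.induct)
  case (single r)
  then obtain t where t: "s < t" "d r t < 0" by auto
  have "(\<Prod>i<n. d i t) = d r t * (\<Prod>i\<in>{..<n} - {r}. d i t)"
    using single by (subst prod.remove[of _ r]) auto
  moreover have "0 < (\<Prod>i\<in>{..<n} - {r}. d i t)"
    using single t by (intro prod_pos) auto
  ultimately show ?case
    using t by (auto simp: det_decoupled_mat_singleton mult_neg_pos)
next
  case (add_leaf V l u)
  note l = add_leaf.hyps(2-)
  note cont = add_leaf.prems(2) and lim = add_leaf.prems(3) and pos = add_leaf.prems(4)
  have lt: "l < n" "u < n" "V \<subseteq> {..<n}" and "u \<noteq> l"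
    using l(1,2) add_leaf.prems(1) by auto
  define c where "c = (W u l)\<^sup>2"
  have "0 < c" using l(3) by (simp add: c_def)
  define d' where "d' = d(u := \<lambda>t. d u t - c / d l t)"
  have "\<exists>z\<ge>s. (\<forall>t>z. 0 < d l t) \<and> (\<exists>v\<in>V. \<exists>t>z. d' v t < 0)"
  proof (cases "\<exists>t>s. d l t \<le> 0")
    \<comment> \<open>The last zero of \<open>d l\<close> becomes the new threshold, and the pole
      there supplies a negative value at \<open>u\<close>.\<close>
    case True
    then obtain z where z: "s < z" "d l z = 0" "\<And>t. z < t \<Longrightarrow> 0 < d l t"
      using last_zero[OF cont lim] by (metis insertI1)
    have "isCont (d v) z" if "v \<in> {u, l}" for v
      using cont[of v] that l(2) z by (auto simp: continuous_on_eq_continuous_at)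
    then have "\<exists>t>z. d u t - c / d l t < 0"
      using z \<open>0 < c\<close> by (intro schur_complement_negative) auto
    then show ?thesis
      using z l(2) by (intro exI[of _ z]) (auto simp: d'_def)
  next
    \<comment> \<open>The threshold stays at \<open>s\<close>. The known negative value must belong
      to a vertex of \<open>V\<close>, and if that vertex is \<open>u\<close>, the correction only
      lowers it.\<close>
    case False
    then have pos_l: "0 < d l t" if "s < t" for t using that by force
    obtain v t where v: "v \<in> V" "s < t" "d v t < 0"
      using add_leaf.prems(5) pos_l by (metis insertE less_asym)
    then have "d' v t < 0"
      using pos_l[of t] \<open>0 < c\<close>
      by (auto simp: d'_def intro: less_trans[OF _ divide_pos_pos])
    then show ?thesis
      using v pos_l by (intro exI[of _ s]) auto
  qed
  then obtain z where z: "s \<le> z" "\<And>t. z < t \<Longrightarrow> 0 < d l t" "\<exists>v\<in>V. \<exists>t>z. d' v t < 0"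
    by auto
  have sub: "{z<..} \<subseteq> {s<..}" using z by auto
  have "\<exists>t>z. det (decoupled_mat n W V (\<lambda>i. d' i t)) < 0"
  proof (rule add_leaf.IH)
    fix v assume "v \<in> V"
    then show "continuous_on {z<..} (d' v)"
      using z(2)
      by (auto simp: d'_def less_imp_neq[symmetric]
          intro!: continuous_intros continuous_on_subset[OF cont sub])
    show "filterlim (d' v) at_top at_top"
      using \<open>v \<in> V\<close> l(2) lim by (auto simp: d'_def intro!: schur_complement_tendsto)
  next
    fix i t assume "i \<in> {..<n} - V" "z < t"
    then show "0 < d' i t"
      using pos[of i t] z l(2) by (cases "i = l") (auto simp: d'_def)
  qed (use lt z in auto)
  then obtain t where t: "z < t" "det (decoupled_mat n W V (\<lambda>i. d' i t)) < 0" by auto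
  have "det (decoupled_mat n W (insert l V) (\<lambda>i. d i t)) =
      det (decoupled_mat n W V ((\<lambda>i. d i t)(u := d u t - (W u l)\<^sup>2 / d l t)))"
  proof (rule det_eliminate_leaf)
    show "W v l = 0 \<and> W l v = 0" if "v \<in> V" "v \<noteq> u" for v
      using that l(4)[of v] sym[of l v] subsetD[OF lt(3) that(1)] lt(1) by auto
  qed (use l(1,2) lt sym[of l u] z(2)[OF t(1)] in auto)
  also have "(\<lambda>i. d i t)(u := d u t - (W u l)\<^sup>2 / d l t) = (\<lambda>i. d' i t)"
    by (auto simp: d'_def c_def)
  finally show ?case
    using t z by (intro exI[of _ t]) auto
qed

theorem proposition2p1:
  fixes n :: nat and G :: "nat pair_pre_digraph"
  assumes "pverts G = {0..<n}"
    and "undirected_tree G"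
  shows "\<not> allows_square_char_poly n G"
proof
  assume "allows_square_char_poly n G"
  then obtain A :: "real mat" and g where A: "A \<in> carrier_mat n n" "transpose_mat A = A"
    and adj: "\<And>i j. i < n \<Longrightarrow> j < n \<Longrightarrow> i \<noteq> j \<Longrightarrow> A $$ (i, j) \<noteq> 0 \<longleftrightarrow> (i, j) \<in> parcs G"
    and g: "char_poly A = g\<^sup>2"
    by (auto simp: allows_square_char_poly_def symmetric_matrices_of_def)
  interpret pair_graph G
    using assms by (simp add: undirected_tree_def)
  \<comment> \<open>The sign is that of the off-diagonal part of \<open>t I - A\<close>. The guard
    makes the support of \<open>W\<close> exactly the arc set, also for indices beyond the dimension
    of \<open>A\<close>.\<close>
  define W where "W i j = (if (i, j) \<in> parcs G then - A $$ (i, j) else 0)" for i j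
  have W_arc: "(\<lambda>i j. W i j \<noteq> 0) = (\<lambda>i j. (i, j) \<in> parcs G)"
  proof (intro ext)
    fix i j
    have "A $$ (i, j) \<noteq> 0" if "(i, j) \<in> parcs G"
      using adj[of i j] that wellformed'[OF that] no_loops'[OF that] assms(1) by auto
    then show "(W i j \<noteq> 0) = ((i, j) \<in> parcs G)"
      by (auto simp: W_def)
  qed
  have tree: "leaf_built (\<lambda>i j. W i j \<noteq> 0) {0..<n}"
    using assms leaf_built_pverts by (simp add: W_arc undirected_tree_def)
  then have "0 < n"
    by (rule contrapos_pp) (auto elim: leaf_built.cases)
  have symA: "A $$ (i, j) = A $$ (j, i)" if "i < n" "j < n" for i j
    using A that by (metis carrier_matD index_transpose_mat(1))
  \<comment> \<open>Any start below \<open>A $$ (0, 0)\<close> would do: the diagonal entry at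
    vertex \<open>0\<close> is negative just after it. Nothing is eliminated yet, so no pivot needs
    to be positive.\<close>
  have "\<exists>t>A $$ (0, 0) - 1. det (decoupled_mat n W {0..<n} (\<lambda>i. t - A $$ (i, i))) < 0"
  proof (rule det_decoupled_mat_negative[OF tree])
    show "W i j = W j i" if "i < n" "j < n" for i j
      using that symA arcs_symmetric by (auto simp: W_def)
    show "filterlim (\<lambda>t. t - A $$ (v, v)) at_top at_top" for v
      using filterlim_tendsto_add_at_top[OF tendsto_const filterlim_ident, of "- A $$ (v, v)"]
      by (simp add: algebra_simps)
    show "\<exists>v\<in>{0..<n}. \<exists>t>A $$ (0, 0) - 1. t - A $$ (v, v) < 0"
      using \<open>0 < n\<close> by (intro bexI[of _ 0] exI[of _ "A $$ (0, 0) - 1 / 2"]) auto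
  qed (auto intro!: continuous_intros)
  then obtain t where "det (decoupled_mat n W {0..<n} (\<lambda>i. t - A $$ (i, i))) < 0" by auto
  \<comment> \<open>\<open>char_matrix A t\<close> is \<open>A - t I\<close>, hence the minus
    sign.\<close>
  moreover have "decoupled_mat n W {0..<n} (\<lambda>i. t - A $$ (i, i)) = - char_matrix A t"
    using A adj by (intro eq_matI) (auto simp: decoupled_mat_def char_matrix_def W_def)
  ultimately have "poly (char_poly A) t < 0"
    using char_poly_matrix[OF A(1)] by simp
  with g show False by simp
qed

end
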